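(* Two states $|G_{abcd}\rangle$ and $|G_{a'b'c'd'}\rangle$ of the family defined in the context are SLOCC-equivalent if and only if their coefficients are related by the following three operations: multiplication by a phase factor, $(a',b',c',d')=e^{i\phi}(a,b,c,d)$; permutation of coefficients, $(a',b',c',d')=\sigma(a,b,c,d)$; and change of sign in front of two coefficients from $a,b,c,d$.
   Context: For $a,b,c,d\in\mathbb C$ with $a^2,b^2,c^2,d^2$ pairwise different, the four-qubit state $|G_{abcd}\rangle\in(\mathbb C^2)^{\otimes4}$ is $$|G_{abcd}\rangle=\tfrac{a+d}{2}(|0000\rangle+|1111\rangle)+\tfrac{a-d}{2}(|0011\rangle+|1100\rangle)+\tfrac{b+c}{2}(|0101\rangle+|1010\rangle)+\tfrac{b-c}{2}(|0110\rangle+|1001\rangle).$$ Both $(a,b,c,d)$ and $(a',b',c',d')$ satisfy the condition of pairwise different squares. "Related by the three operations" means that one tuple is obtained from the other by composing operations of these kinds. Quantum states are regarded as elements of a projective space. Two four-qubit states $|\psi\rangle,|\phi\rangle$ are SLOCC-equivalent if there are $\mathcal O_1,\dots,\mathcal O_4\in\mathrm{SL}(2,\mathbb C)$ with $(\mathcal O_1\otimes\mathcal O_2\otimes\mathcal O_3\otimes\mathcal O_4)|\psi\rangle\propto|\phi\rangle$.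
   Formalization: Proved for states of equal norm, and for all states with coefficients related by the three operations up to a positive rescaling; without this "only if" fails, e.g. (1,2,3,4) and (2,4,6,8) give the same projective state but no phase, permutation or sign changes relate them. *)

theory Defs
  imports "HOL-Analysis.Analysis"
begin

text \<open>
  The index type \<open>2\<close> is the ring of integers modulo 2, with elements \<open>0\<close> and \<open>1\<close>, so
  \<open>ket i j k l\<close> below is literally the computational basis vector \<open>|ijkl\<rangle>\<close>.
\<close>

type_synonym four_qubit = "complex ^ (2 \<times> 2 \<times> 2 \<times> 2)"

definition ket :: "2 \<Rightarrow> 2 \<Rightarrow> 2 \<Rightarrow> 2 \<Rightarrow> four_qubit" where
  "ket i j k l = axis (i, j, k, l) 1"

definition G_state :: "complex \<Rightarrow> complex \<Rightarrow> complex \<Rightarrow> complex \<Rightarrow> four_qubit" where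
  "G_state a b c d =
     ((a + d) / 2) *s (ket 0 0 0 0 + ket 1 1 1 1) +
     ((a - d) / 2) *s (ket 0 0 1 1 + ket 1 1 0 0) +
     ((b + c) / 2) *s (ket 0 1 0 1 + ket 1 0 1 0) +
     ((b - c) / 2) *s (ket 0 1 1 0 + ket 1 0 0 1)"

definition tensor4 ::
  "complex^2^2 \<Rightarrow> complex^2^2 \<Rightarrow> complex^2^2 \<Rightarrow> complex^2^2 \<Rightarrow>
   complex ^ (2 \<times> 2 \<times> 2 \<times> 2) ^ (2 \<times> 2 \<times> 2 \<times> 2)" where
  "tensor4 A B C D = (\<chi> p q. case p of (i, j, k, l) \<Rightarrow> case q of (i', j', k', l') \<Rightarrow>
     A $ i $ i' * B $ j $ j' * C $ k $ k' * D $ l $ l')"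

text \<open>
  States are points of a projective space; they are represented by nonzero vectors, and
  \<open>proportional\<close> is equality of the represented points.
\<close>

definition proportional :: "four_qubit \<Rightarrow> four_qubit \<Rightarrow> bool" where
  "proportional \<psi> \<phi> \<longleftrightarrow> (\<exists>z. z \<noteq> 0 \<and> \<psi> = z *s \<phi>)"

definition slocc_equiv :: "four_qubit \<Rightarrow> four_qubit \<Rightarrow> bool" where
  "slocc_equiv \<psi> \<phi> \<longleftrightarrow>
     (\<exists>A B C D. det A = 1 \<and> det B = 1 \<and> det C = 1 \<and> det D = 1 \<and>
        proportional (tensor4 A B C D *v \<psi>) \<phi>)"

inductive coeff_step :: "complex^4 \<Rightarrow> complex^4 \<Rightarrow> bool" where
  phase: "coeff_step x (cis \<phi> *s x)"
| permutation: "bij \<sigma> \<Longrightarrow> coeff_step x (\<chi> i. x $ \<sigma> i)"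
| two_signs: "i \<noteq> j \<Longrightarrow> coeff_step x (\<chi> k. if k = i \<or> k = j then - x $ k else x $ k)"

text \<open>
  Each kind of operation is closed under inverses, so the reflexive transitive closure is
  already symmetric.
\<close>

definition coeff_related :: "complex^4 \<Rightarrow> complex^4 \<Rightarrow> bool" where
  "coeff_related = coeff_step\<^sup>*\<^sup>*"

end

theory Submission
  imports Defs
begin

text \<open>
  Read a state as a \<open>4 \<times> 4\<close> matrix \<open>M\<close> from the last two qubits to the first two. The local
  operations act by \<open>M \<mapsto> K M L\<^sup>T\<close> with \<open>K = A \<otimes> B\<close> and \<open>L = C \<otimes> D\<close>, which have determinant 1
  and preserve the symmetric form \<open>S = \<epsilon> \<otimes> \<epsilon>\<close>. Hence \<open>M S M\<^sup>T S\<close> changes by conjugation with \<open>K\<close>,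
  and \<open>det M\<close> is invariant. The matrix of \<open>G_state a b c d\<close> is diagonal in the Bell basis with
  eigenvalues \<open>a, b, c, d\<close>, and \<open>M S M\<^sup>T S\<close> is the matrix of \<open>G_state (a\<^sup>2) (b\<^sup>2) (c\<^sup>2) (d\<^sup>2)\<close>. Equivalent
  states therefore have, up to a common factor, the same squares \<open>a\<^sup>2, b\<^sup>2, c\<^sup>2, d\<^sup>2\<close> and
  the same product \<open>a b c d\<close>; the product forces the number of sign changes to be even, unless
  some coefficient is zero, whose sign is then free. Conversely, Pauli matrices, the Hadamard matrix
  and the phase gate, rescaled to determinant 1, realise the sign changes and transpositions.
\<close>

section \<open>Indices modulo 2 and explicit small determinants\<close>

text \<open>Library facts about the type \<open>2\<close> speak of the indices 1 and 2; this
  identity turns them into facts about 0 and 1.\<close>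

lemma two_eq_zero: "(2::2) = 0"
  by (simp add: numeral_2_eq_2)

lemma UNIV_2': "(UNIV :: 2 set) = {0, 1}"
  using UNIV_2 two_eq_zero by auto

lemma exhaust_2': "i = 0 \<or> i = 1" for i :: 2
  using exhaust_2[of i] two_eq_zero by auto

lemma forall_2': "(\<forall>i::2. P i) \<longleftrightarrow> P 0 \<and> P 1"
  by (metis exhaust_2')

lemma sum_2': "sum f (UNIV :: 2 set) = f 0 + f 1"
  unfolding UNIV_2' by simp

lemma UNIV_2_times_2: "(UNIV :: (2 \<times> 2) set) = {(0, 0), (0, 1), (1, 0), (1, 1)}"
  unfolding UNIV_Times_UNIV[symmetric] UNIV_2' by auto

lemma sum_UNIV_prod:
  "sum f (UNIV :: ('a::finite \<times> 'b::finite) set) = (\<Sum>i\<in>UNIV. \<Sum>j\<in>UNIV. f (i, j))"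
  unfolding UNIV_Times_UNIV[symmetric] by (simp add: sum.cartesian_product)

lemma det_2':
  fixes A :: "'a::comm_ring_1^2^2"
  shows "det A = A$0$0 * A$1$1 - A$0$1 * A$1$0"
  unfolding det_2 two_eq_zero by (simp add: algebra_simps)

lemma det_2_times_2:
  fixes A :: "'a::comm_ring_1^(2\<times>2)^(2\<times>2)"
  shows "det A =
    A$(0,0)$(0,0) * (A$(0,1)$(0,1) * (A$(1,0)$(1,0) * A$(1,1)$(1,1) - A$(1,0)$(1,1) * A$(1,1)$(1,0))
                   - A$(0,1)$(1,0) * (A$(1,0)$(0,1) * A$(1,1)$(1,1) - A$(1,0)$(1,1) * A$(1,1)$(0,1))
                   + A$(0,1)$(1,1) * (A$(1,0)$(0,1) * A$(1,1)$(1,0) - A$(1,0)$(1,0) * A$(1,1)$(0,1)))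
  - A$(0,0)$(0,1) * (A$(0,1)$(0,0) * (A$(1,0)$(1,0) * A$(1,1)$(1,1) - A$(1,0)$(1,1) * A$(1,1)$(1,0))
                   - A$(0,1)$(1,0) * (A$(1,0)$(0,0) * A$(1,1)$(1,1) - A$(1,0)$(1,1) * A$(1,1)$(0,0))
                   + A$(0,1)$(1,1) * (A$(1,0)$(0,0) * A$(1,1)$(1,0) - A$(1,0)$(1,0) * A$(1,1)$(0,0)))
  + A$(0,0)$(1,0) * (A$(0,1)$(0,0) * (A$(1,0)$(0,1) * A$(1,1)$(1,1) - A$(1,0)$(1,1) * A$(1,1)$(0,1))
                   - A$(0,1)$(0,1) * (A$(1,0)$(0,0) * A$(1,1)$(1,1) - A$(1,0)$(1,1) * A$(1,1)$(0,0))
                   + A$(0,1)$(1,1) * (A$(1,0)$(0,0) * A$(1,1)$(0,1) - A$(1,0)$(0,1) * A$(1,1)$(0,0)))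
  - A$(0,0)$(1,1) * (A$(0,1)$(0,0) * (A$(1,0)$(0,1) * A$(1,1)$(1,0) - A$(1,0)$(1,0) * A$(1,1)$(0,1))
                   - A$(0,1)$(0,1) * (A$(1,0)$(0,0) * A$(1,1)$(1,0) - A$(1,0)$(1,0) * A$(1,1)$(0,0))
                   + A$(0,1)$(1,0) * (A$(1,0)$(0,0) * A$(1,1)$(0,1) - A$(1,0)$(0,1) * A$(1,1)$(0,0)))"
proof -
  have f4: "finite {(0::2,1::2), (1,0), (1,1)}" "(0,0) \<notin> {(0::2,1::2), (1,0), (1,1)}"
    by auto
  have f3: "finite {(1::2,0::2), (1,1)}" "(0,1) \<notin> {(1::2,0::2), (1,1)}"
    by auto
  have f2: "finite {(1::2,1::2)}" "(1,0) \<notin> {(1::2,1::2)}"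
    by auto
  show ?thesis
    unfolding det_def UNIV_2_times_2
    unfolding sum_over_permutations_insert[OF f4]
    unfolding sum_over_permutations_insert[OF f3]
    unfolding sum_over_permutations_insert[OF f2]
    unfolding permutes_sing
    by (simp add: sign_swap_id permutation_swap_id permutation_compose sign_compose sign_id swap_id_eq transpose_def
       algebra_simps)
qed

section \<open>Kronecker products and the matrix of a state\<close>

definition kron :: "complex^2^2 \<Rightarrow> complex^2^2 \<Rightarrow> complex^(2\<times>2)^(2\<times>2)" where
  "kron A B = (\<chi> p q. A $ fst p $ fst q * B $ snd p $ snd q)"

definition unfold_state :: "four_qubit \<Rightarrow> complex^(2\<times>2)^(2\<times>2)" where
  "unfold_state \<psi> = (\<chi> p q. \<psi> $ (fst p, snd p, fst q, snd q))"

lemma unfold_state_inject: "unfold_state \<psi> = unfold_state \<phi> \<longleftrightarrow> \<psi> = \<phi>"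
  by (auto simp: unfold_state_def vec_eq_iff)

lemma kron_mult: "kron A B ** kron C D = kron (A ** C) (B ** D)"
  by (simp add: kron_def matrix_matrix_mult_def vec_eq_iff sum_UNIV_prod sum_2' algebra_simps)

lemma transpose_kron: "transpose (kron A B) = kron (transpose A) (transpose B)"
  by (simp add: kron_def transpose_def vec_eq_iff)

lemma det_kron: "det (kron A B) = (det A)\<^sup>2 * (det B)\<^sup>2"
  unfolding det_2_times_2 det_2' kron_def by (simp, algebra)

lemma unfold_tensor4:
  "unfold_state (tensor4 A B C D *v \<psi>) = kron A B ** unfold_state \<psi> ** transpose (kron C D)"
  by (simp add: kron_def unfold_state_def tensor4_def matrix_vector_mult_def transpose_def
    matrix_matrix_mult_def vec_eq_iff sum_UNIV_prod sum_2' algebra_simps)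

lemma G_state_entries:
  "unfold_state (G_state a b c d) $ (i, j) $ (k, l) =
    (if i = j then if k = l then if i = k then (a + d) / 2 else (a - d) / 2 else 0
     else if k = l then 0 else if i = k then (b + c) / 2 else (b - c) / 2)"
proof -
  have "\<forall>i j k l. unfold_state (G_state a b c d) $ (i, j) $ (k, l) =
    (if i = j then if k = l then if i = k then (a + d) / 2 else (a - d) / 2 else 0
     else if k = l then 0 else if i = k then (b + c) / 2 else (b - c) / 2)"
    unfolding forall_2' by (simp add: unfold_state_def G_state_def ket_def axis_def)
  then show ?thesis by blast
qed

lemma G_state_scale: "z *s G_state a b c d = G_state (z * a) (z * b) (z * c) (z * d)"
  by (simp add: G_state_def vec_eq_iff algebra_simps add_divide_distrib diff_divide_distrib)

text \<open>\<open>a\<close>, \<open>b\<close>, \<open>c\<close>, \<open>d\<close> are the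
  coordinates of the state in an orthonormal family, each Bell vector tensored with itself; in the
  standard basis this becomes the parallelogram law.\<close>

lemma norm_G_state:
  "(norm (G_state a b c d))\<^sup>2 = (cmod a)\<^sup>2 + (cmod b)\<^sup>2 + (cmod c)\<^sup>2 + (cmod d)\<^sup>2"
proof -
  have entry: "G_state a b c d $ (i, j, k, l) = unfold_state (G_state a b c d) $ (i, j) $ (k, l)"
    for i j k l by (simp add: unfold_state_def)
  have parallelogram: "(cmod ((x + y) / 2))\<^sup>2 + (cmod ((x - y) / 2))\<^sup>2 = ((cmod x)\<^sup>2 + (cmod y)\<^sup>2) / 2" for x y
    unfolding norm_divide cmod_power2 power_divide by (simp add: field_simps power2_eq_square)
  have "(norm (G_state a b c d))\<^sup>2 = (\<Sum>i\<in>UNIV. (cmod (G_state a b c d $ i))\<^sup>2)"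
    by (simp add: norm_vec_def L2_set_def sum_nonneg)
  also have "\<dots> = 2 * ((cmod ((a + d) / 2))\<^sup>2 + (cmod ((a - d) / 2))\<^sup>2) +
      2 * ((cmod ((b + c) / 2))\<^sup>2 + (cmod ((b - c) / 2))\<^sup>2)"
    by (simp add: sum_UNIV_prod sum_2' entry G_state_entries del: norm_divide)
  finally show ?thesis
    unfolding parallelogram by (simp add: field_simps)
qed

lemma det_G_state: "det (unfold_state (G_state a b c d)) = a * b * c * d"
  unfolding det_2_times_2 by (simp add: G_state_entries field_simps)

text \<open>Phrasing eigenvalues through eigenvectors lets them be carried along an intertwining
  matrix directly, by applying that matrix to the eigenvector.\<close>

lemma G_state_eigenvalue_iff:
  "(\<exists>w. w \<noteq> 0 \<and> unfold_state (G_state a b c d) *v w = t *s w) \<longleftrightarrow> t \<in> {a, b, c, d}"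
proof
  assume "\<exists>w. w \<noteq> 0 \<and> unfold_state (G_state a b c d) *v w = t *s w"
  then obtain w where w: "w \<noteq> 0" "unfold_state (G_state a b c d) *v w = t *s w" by blast
  have "(a + d) * w$(0,0) + (a - d) * w$(1,1) = 2 * (t * w$(0,0))"
    "(a - d) * w$(0,0) + (a + d) * w$(1,1) = 2 * (t * w$(1,1))"
    "(b + c) * w$(0,1) + (b - c) * w$(1,0) = 2 * (t * w$(0,1))"
    "(b - c) * w$(0,1) + (b + c) * w$(1,0) = 2 * (t * w$(1,0))"
    using w(2)[unfolded vec_eq_iff, rule_format, of "(0,0)"] w(2)[unfolded vec_eq_iff, rule_format, of "(1,1)"]
      w(2)[unfolded vec_eq_iff, rule_format, of "(0,1)"] w(2)[unfolded vec_eq_iff, rule_format, of "(1,0)"]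
    by (simp_all add: matrix_vector_mult_def sum_UNIV_prod sum_2' G_state_entries flip: add_divide_distrib)
  \<comment> \<open>Sums and differences of paired equations pass to Bell coordinates, in which the
    matrix is diagonal.\<close>
  then have "a * (w$(0,0) + w$(1,1)) = t * (w$(0,0) + w$(1,1))"
    "d * (w$(0,0) - w$(1,1)) = t * (w$(0,0) - w$(1,1))"
    "b * (w$(0,1) + w$(1,0)) = t * (w$(0,1) + w$(1,0))"
    "c * (w$(0,1) - w$(1,0)) = t * (w$(0,1) - w$(1,0))"
    by algebra+
  note eqs = this
  show "t \<in> {a, b, c, d}"
  proof (rule ccontr)
    assume "t \<notin> {a, b, c, d}"
    with eqs have "w$(0,0) + w$(1,1) = 0" "w$(0,0) - w$(1,1) = 0" "w$(0,1) + w$(1,0) = 0" "w$(0,1) - w$(1,0) = 0"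
      by auto
    then have "w$(0,0) = 0" "w$(0,1) = 0" "w$(1,0) = 0" "w$(1,1) = 0" by auto
    then have "w = 0" by (simp add: vec_eq_iff forall_2')
    with w(1) show False ..
  qed
next
  assume "t \<in> {a, b, c, d}"
  \<comment> \<open>The four witnesses are the unnormalised Bell vectors.\<close>
  moreover have "\<exists>w. w \<noteq> 0 \<and> unfold_state (G_state a b c d) *v w = a *s w"
    by (rule exI[of _ "\<chi> p. if p = (0,0) then 1 else if p = (1,1) then 1 else 0"])
      (auto simp: vec_eq_iff forall_2' matrix_vector_mult_def sum_UNIV_prod sum_2' G_state_entries field_simps)
  moreover have "\<exists>w. w \<noteq> 0 \<and> unfold_state (G_state a b c d) *v w = d *s w"
    by (rule exI[of _ "\<chi> p. if p = (0,0) then 1 else if p = (1,1) then -1 else 0"])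
      (auto simp: vec_eq_iff forall_2' matrix_vector_mult_def sum_UNIV_prod sum_2' G_state_entries field_simps)
  moreover have "\<exists>w. w \<noteq> 0 \<and> unfold_state (G_state a b c d) *v w = b *s w"
    by (rule exI[of _ "\<chi> p. if p = (0,1) then 1 else if p = (1,0) then 1 else 0"])
      (auto simp: vec_eq_iff forall_2' matrix_vector_mult_def sum_UNIV_prod sum_2' G_state_entries field_simps)
  moreover have "\<exists>w. w \<noteq> 0 \<and> unfold_state (G_state a b c d) *v w = c *s w"
    by (rule exI[of _ "\<chi> p. if p = (0,1) then 1 else if p = (1,0) then -1 else 0"])
      (auto simp: vec_eq_iff forall_2' matrix_vector_mult_def sum_UNIV_prod sum_2' G_state_entries field_simps)
  ultimately show "\<exists>w. w \<noteq> 0 \<and> unfold_state (G_state a b c d) *v w = t *s w"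
    by blast
qed

section \<open>Invariants of local operations\<close>

definition spin_form :: "complex^(2\<times>2)^(2\<times>2)" where
  "spin_form = (let \<epsilon> = (\<chi> i j. if i = j then 0 else if i = 0 then 1 else -1) in kron \<epsilon> \<epsilon>)"

text \<open>For 2 by 2 matrices \<open>transpose X ** \<epsilon> ** X\<close> is
  \<open>det X\<close> times \<open>\<epsilon>\<close>, so determinant 1 preserves
  \<open>\<epsilon>\<close> in each tensor factor.\<close>

lemma kron_preserves_spin_form:
  assumes "det A = 1" "det B = 1"
  shows "transpose (kron A B) ** spin_form ** kron A B = spin_form"
proof -
  define \<epsilon> :: "complex^2^2" where "\<epsilon> = (\<chi> i j. if i = j then 0 else if i = 0 then 1 else -1)"
  have *: "transpose X ** \<epsilon> ** X = \<epsilon>" if "det X = 1" for X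
    using that unfolding det_2' \<epsilon>_def
    by (simp add: vec_eq_iff forall_2' matrix_matrix_mult_def transpose_def sum_2', algebra)
  show ?thesis
    using assms by (simp add: spin_form_def \<epsilon>_def[symmetric] Let_def transpose_kron kron_mult *)
qed

text \<open>The matrix of the state is symmetric and commutes with \<open>spin_form\<close>, both
  being diagonal in the Bell basis. Since \<open>spin_form\<close> squares to the identity, the
  product is the square of that matrix.\<close>

lemma G_state_spin_square:
  "unfold_state (G_state a b c d) ** spin_form ** transpose (unfold_state (G_state a b c d)) ** spin_form =
   unfold_state (G_state (a\<^sup>2) (b\<^sup>2) (c\<^sup>2) (d\<^sup>2))"
  by (simp add: vec_eq_iff forall_2' matrix_matrix_mult_def transpose_def sum_UNIV_prod sum_2'
      spin_form_def kron_def Let_def G_state_entries field_simps power2_eq_square)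

lemma det_kron_1: "det A = 1 \<Longrightarrow> det B = 1 \<Longrightarrow> det (kron A B) = 1"
  by (simp add: det_kron)

text \<open>The proportionality factor \<open>z\<close> is absorbed into the primed coefficients. An
  inclusion of the sets of squares is enough: when the squares on the left are distinct, counting
  makes it a bijection.\<close>

lemma slocc_equiv_G_state_invariants:
  assumes "slocc_equiv (G_state a b c d) (G_state a' b' c' d')"
  obtains z where "z \<noteq> 0"
    "a * b * c * d = (z * a') * (z * b') * (z * c') * (z * d')"
    "{a\<^sup>2, b\<^sup>2, c\<^sup>2, d\<^sup>2} \<subseteq> {(z * a')\<^sup>2, (z * b')\<^sup>2, (z * c')\<^sup>2, (z * d')\<^sup>2}"
proof -
  obtain A B C D z where dets: "det A = 1" "det B = 1" "det C = 1" "det D = 1" and z: "z \<noteq> 0"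
    and eq: "tensor4 A B C D *v G_state a b c d = z *s G_state a' b' c' d'"
    using assms unfolding slocc_equiv_def proportional_def by blast
  define K where "K = kron A B"
  define L where "L = kron C D"
  define M where "M = unfold_state (G_state a b c d)"
  define M' where "M' = unfold_state (G_state (z * a') (z * b') (z * c') (z * d'))"
  have M': "K ** M ** transpose L = M'"
    using eq by (simp add: K_def L_def M_def M'_def flip: unfold_tensor4 G_state_scale)
  have dK: "det K = 1" "det L = 1"
    using dets by (simp_all add: K_def L_def det_kron_1)
  have "det M = det M'"
    using dK by (simp add: det_mul flip: M')
  have S: "transpose K ** spin_form ** K = spin_form" "transpose L ** spin_form ** L = spin_form"
    using dets by (simp_all add: K_def L_def kron_preserves_spin_form)
  \<comment> \<open>Both bracketed factors collapse to \<open>spin_form\<close>: this removes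
    \<open>L\<close> and leaves a single \<open>K\<close> on the left.\<close>
  have "(M' ** spin_form ** transpose M' ** spin_form) ** K =
      K ** M ** (transpose L ** spin_form ** L) ** transpose M ** (transpose K ** spin_form ** K)"
    unfolding M'[symmetric] by (simp add: matrix_transpose_mul matrix_mul_assoc)
  then have intertwine: "(M' ** spin_form ** transpose M' ** spin_form) ** K =
      K ** (M ** spin_form ** transpose M ** spin_form)"
    unfolding S by (simp add: matrix_mul_assoc)
  have "t \<in> {(z * a')\<^sup>2, (z * b')\<^sup>2, (z * c')\<^sup>2, (z * d')\<^sup>2}" if t: "t \<in> {a\<^sup>2, b\<^sup>2, c\<^sup>2, d\<^sup>2}" for t
  proof -
    obtain w where w: "w \<noteq> 0" "unfold_state (G_state (a\<^sup>2) (b\<^sup>2) (c\<^sup>2) (d\<^sup>2)) *v w = t *s w"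
      using t unfolding G_state_eigenvalue_iff[symmetric] by blast
    \<comment> \<open>\<open>K\<close> carries the eigenvector \<open>w\<close> to an eigenvector
      for the same \<open>t\<close>, provided the image is nonzero.\<close>
    have "K *v w \<noteq> 0"
    proof
      assume "K *v w = 0"
      moreover obtain K' where "K' ** K = mat 1"
        using dK by (metis invertible_det_nz invertible_def zero_neq_one)
      ultimately have "w = K' *v 0"
        by (metis matrix_vector_mul_assoc matrix_vector_mul_lid)
      with w(1) show False by simp
    qed
    moreover have "unfold_state (G_state ((z * a')\<^sup>2) ((z * b')\<^sup>2) ((z * c')\<^sup>2) ((z * d')\<^sup>2)) *v (K *v w) = t *s (K *v w)"
    proof -
      have "unfold_state (G_state ((z * a')\<^sup>2) ((z * b')\<^sup>2) ((z * c')\<^sup>2) ((z * d')\<^sup>2)) ** K =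
          K ** unfold_state (G_state (a\<^sup>2) (b\<^sup>2) (c\<^sup>2) (d\<^sup>2))"
        using intertwine unfolding M_def M'_def G_state_spin_square .
      then show ?thesis
        by (simp only: matrix_vector_mul_assoc) (simp only: w(2) vector_scalar_commute flip: matrix_vector_mul_assoc)
    qed
    ultimately have "\<exists>w. w \<noteq> 0 \<and> unfold_state (G_state ((z * a')\<^sup>2) ((z * b')\<^sup>2) ((z * c')\<^sup>2) ((z * d')\<^sup>2)) *v w = t *s w"
      by (intro exI conjI)
    then show ?thesis
      unfolding G_state_eigenvalue_iff .
  qed
  then have "{a\<^sup>2, b\<^sup>2, c\<^sup>2, d\<^sup>2} \<subseteq> {(z * a')\<^sup>2, (z * b')\<^sup>2, (z * c')\<^sup>2, (z * d')\<^sup>2}"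
    by (rule subsetI)
  moreover have "a * b * c * d = (z * a') * (z * b') * (z * c') * (z * d')"
    using \<open>det M = det M'\<close> unfolding M_def M'_def det_G_state .
  ultimately show thesis
    using that z by simp
qed

section \<open>Composition and rescaling of equivalences\<close>

lemma tensor4_mult:
  "tensor4 A B C D *v (tensor4 A' B' C' D' *v \<psi>) = tensor4 (A ** A') (B ** B') (C ** C') (D ** D') *v \<psi>"
  by (simp add: unfold_tensor4 matrix_transpose_mul matrix_mul_assoc
      flip: unfold_state_inject kron_mult)

lemma slocc_equiv_trans:
  assumes "slocc_equiv \<psi> \<phi>" "slocc_equiv \<phi> \<omega>"
  shows "slocc_equiv \<psi> \<omega>"
proof -
  obtain A B C D z where 1: "det A = 1" "det B = 1" "det C = 1" "det D = 1" "z \<noteq> 0"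
    "tensor4 A B C D *v \<psi> = z *s \<phi>"
    using assms(1) unfolding slocc_equiv_def proportional_def by blast
  obtain A' B' C' D' z' where 2: "det A' = 1" "det B' = 1" "det C' = 1" "det D' = 1" "z' \<noteq> 0"
    "tensor4 A' B' C' D' *v \<phi> = z' *s \<omega>"
    using assms(2) unfolding slocc_equiv_def proportional_def by blast
  have "tensor4 (A' ** A) (B' ** B) (C' ** C) (D' ** D) *v \<psi> = (z * z') *s \<omega>"
    by (simp add: 1 2 vector_scalar_commute vector_smult_assoc flip: tensor4_mult)
  moreover have "z * z' \<noteq> 0" "det (A' ** A) = 1" "det (B' ** B) = 1" "det (C' ** C) = 1" "det (D' ** D) = 1"
    using 1 2 by (simp_all add: det_mul)
  ultimately show ?thesis
    unfolding slocc_equiv_def proportional_def by blast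
qed

text \<open>Identity operators do this. The case \<open>z = 1\<close> serves as reflexivity, the
  case \<open>z = -1\<close> as a simultaneous sign change.\<close>

lemma slocc_equiv_scale:
  assumes "z \<noteq> 0"
  shows "slocc_equiv \<psi> (z *s \<psi>)"
proof -
  have "kron (mat 1) (mat 1) = mat 1"
    by (simp add: kron_def mat_def vec_eq_iff forall_2')
  then have "tensor4 (mat 1) (mat 1) (mat 1) (mat 1) *v \<psi> = \<psi>"
    by (simp add: unfold_tensor4 transpose_mat flip: unfold_state_inject)
  also have "\<dots> = inverse z *s (z *s \<psi>)"
    using assms by (simp add: vector_smult_assoc)
  finally show ?thesis
    unfolding slocc_equiv_def proportional_def using assms by (metis det_I inverse_nonzero_iff_nonzero)
qed

lemma slocc_equiv_unfoldI:
  assumes "det A = 1" "det B = 1" "det C = 1" "det D = 1"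
    and "kron A B ** unfold_state \<psi> ** transpose (kron C D) = unfold_state \<phi>"
  shows "slocc_equiv \<psi> \<phi>"
proof -
  have "tensor4 A B C D *v \<psi> = 1 *s \<phi>"
    using assms(5) by (simp flip: unfold_tensor4 add: unfold_state_inject)
  then show ?thesis
    unfolding slocc_equiv_def proportional_def using assms(1-4) by (metis zero_neq_one)
qed

section \<open>Gates realising swaps and sign changes\<close>

definition mat2 :: "complex \<Rightarrow> complex \<Rightarrow> complex \<Rightarrow> complex \<Rightarrow> complex^2^2" where
  "mat2 p q r s = (\<chi> i j. if i = 0 then if j = 0 then p else q else if j = 0 then r else s)"

lemma det_mat2: "det (mat2 p q r s) = p * s - q * r"
  by (simp add: det_2' mat2_def)

lemmas G_state_action_simps = vec_eq_iff forall_2' matrix_matrix_mult_def transpose_def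
  sum_UNIV_prod sum_2' kron_def mat2_def G_state_entries

text \<open>Phase rotations on the first two qubits and their inverses on the last two only negate
  the entries \<open>(a - d) / 2\<close>, which exchanges \<open>a\<close> and
  \<open>d\<close>.\<close>

lemma slocc_equiv_G_swap14: "slocc_equiv (G_state a b c d) (G_state d b c a)"
proof -
  define w where "w = cis (pi / 4)"
  define v where "v = cis (- (pi / 4))"
  have wv: "w * w = \<i>" "v * v = - \<i>" "w * v = 1" "v * w = 1"
    by (simp_all add: w_def v_def cis_mult)
  have wv': "w * (w * t) = \<i> * t" "v * (v * t) = - \<i> * t" "w * (v * t) = t" "v * (w * t) = t" for t
    by (simp_all add: wv flip: mult.assoc)
  show ?thesis
  proof (rule slocc_equiv_unfoldI)
    show "kron (mat2 w 0 0 v) (mat2 w 0 0 v) ** unfold_state (G_state a b c d) **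
        transpose (kron (mat2 v 0 0 w) (mat2 v 0 0 w)) = unfold_state (G_state d b c a)"
      by (simp add: G_state_action_simps wv wv' field_simps)
  qed (simp_all add: det_mat2 wv)
qed

text \<open>A Hadamard gate on both qubits of a pair exchanges the Bell vectors of \<open>b\<close>
  and \<open>d\<close>, fixes that of \<open>a\<close> and negates that of \<open>c\<close>; this
  sign cancels between the two pairs.\<close>

lemma slocc_equiv_G_swap24: "slocc_equiv (G_state a b c d) (G_state a d c b)"
proof -
  \<comment> \<open>The factor \<open>\<i>\<close> makes the determinant \<open>-2 * s * s\<close>
    of \<open>?H\<close> equal to 1 instead of -1.\<close>
  define s where "s = \<i> * complex_of_real (sqrt (1/2))"
  have s: "s * s = - (1/2)"
  proof -
    have "s * s = (\<i> * \<i>) * complex_of_real (sqrt (1/2) * sqrt (1/2))"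
      by (simp only: s_def of_real_mult mult_ac)
    then show ?thesis by simp
  qed
  let ?H = "mat2 s s s (- s)"
  have *: "s * (s * x) = - x / 2" for x
    by (simp add: s flip: mult.assoc)
  show ?thesis
  proof (rule slocc_equiv_unfoldI)
    show "kron ?H ?H ** unfold_state (G_state a b c d) **
        transpose (kron ?H ?H) = unfold_state (G_state a d c b)"
      by (simp add: G_state_action_simps s * field_simps)
  qed (simp_all add: det_mat2 s)
qed

text \<open>A Pauli Z on one qubit of each pair flips the relative sign in every Bell vector,
  exchanging those of \<open>a\<close> and \<open>d\<close> and those of \<open>b\<close> and
  \<open>c\<close>.\<close>

lemma slocc_equiv_G_swap14_23: "slocc_equiv (G_state a b c d) (G_state d c b a)"
proof (rule slocc_equiv_unfoldI)
  show "kron (mat2 \<i> 0 0 (-\<i>)) (mat2 1 0 0 1) ** unfold_state (G_state a b c d) **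
      transpose (kron (mat2 (-\<i>) 0 0 \<i>) (mat2 1 0 0 1)) = unfold_state (G_state d c b a)"
    by (simp add: G_state_action_simps field_simps)
qed (simp_all add: det_mat2)

text \<open>Here and in the next two lemmas one Pauli matrix (Z, X, Y in turn), times
  \<open>\<i>\<close> for determinant 1, acts on both of the first two qubits. Their product is
  diagonal in the Bell basis with eigenvalue -1 exactly twice.\<close>

lemma slocc_equiv_G_sign14: "slocc_equiv (G_state a b c d) (G_state (-a) b c (-d))"
proof (rule slocc_equiv_unfoldI)
  show "kron (mat2 \<i> 0 0 (-\<i>)) (mat2 \<i> 0 0 (-\<i>)) ** unfold_state (G_state a b c d) **
      transpose (kron (mat2 1 0 0 1) (mat2 1 0 0 1)) = unfold_state (G_state (-a) b c (-d))"
    by (simp add: G_state_action_simps field_simps)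
qed (simp_all add: det_mat2)

lemma slocc_equiv_G_sign12: "slocc_equiv (G_state a b c d) (G_state (-a) (-b) c d)"
proof (rule slocc_equiv_unfoldI)
  show "kron (mat2 0 \<i> \<i> 0) (mat2 0 \<i> \<i> 0) ** unfold_state (G_state a b c d) **
      transpose (kron (mat2 1 0 0 1) (mat2 1 0 0 1)) = unfold_state (G_state (-a) (-b) c d)"
    by (simp add: G_state_action_simps field_simps)
qed (simp_all add: det_mat2)

lemma slocc_equiv_G_sign24: "slocc_equiv (G_state a b c d) (G_state a (-b) c (-d))"
proof (rule slocc_equiv_unfoldI)
  show "kron (mat2 0 1 (-1) 0) (mat2 0 1 (-1) 0) ** unfold_state (G_state a b c d) **
      transpose (kron (mat2 1 0 0 1) (mat2 1 0 0 1)) = unfold_state (G_state a (-b) c (-d))"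
    by (simp add: G_state_action_simps field_simps)
qed (simp_all add: det_mat2)

text \<open>An overall sign is projectively invisible, so a sign change on two coefficients also
  gives the one on the complementary pair; three Pauli cases thus cover all six pairs.\<close>

lemma slocc_equiv_G_state_uminus:
  assumes "slocc_equiv \<psi> (G_state a b c d)"
  shows "slocc_equiv \<psi> (G_state (-a) (-b) (-c) (-d))"
  using slocc_equiv_trans[OF assms slocc_equiv_scale[of "-1"]] by (simp add: G_state_scale)

section \<open>Coefficient operations induce equivalences\<close>

lemma vector_4 [simp]:
  "(vector [p, q, r, s] :: 'a::zero^4) $ 1 = p"
  "(vector [p, q, r, s] :: 'a::zero^4) $ 2 = q"
  "(vector [p, q, r, s] :: 'a::zero^4) $ 3 = r"
  "(vector [p, q, r, s] :: 'a::zero^4) $ 4 = s"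
  by (simp_all add: vector_def)

definition G_vec :: "complex^4 \<Rightarrow> four_qubit" where
  "G_vec x = G_state (x $ 1) (x $ 2) (x $ 3) (x $ 4)"

lemma slocc_equiv_G_vec_two_signs:
  assumes "i \<noteq> j"
  shows "slocc_equiv (G_vec x) (G_vec (\<chi> k. if k = i \<or> k = j then - x $ k else x $ k))"
proof -
  have "slocc_equiv (G_state a b c d) (G_state a b (-c) (-d))"
    "slocc_equiv (G_state a b c d) (G_state a (-b) (-c) d)"
    "slocc_equiv (G_state a b c d) (G_state (-a) b (-c) d)" for a b c d
    using slocc_equiv_G_state_uminus[OF slocc_equiv_G_sign12[of a b c d]]
      slocc_equiv_G_state_uminus[OF slocc_equiv_G_sign14[of a b c d]]
      slocc_equiv_G_state_uminus[OF slocc_equiv_G_sign24[of a b c d]] by simp_all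
  note * = this slocc_equiv_G_sign12 slocc_equiv_G_sign14 slocc_equiv_G_sign24
  have "\<forall>i j. i \<noteq> j \<longrightarrow> slocc_equiv (G_vec x) (G_vec (\<chi> k. if k = i \<or> k = j then - x $ k else x $ k))"
    unfolding forall_4 by (simp add: G_vec_def *)
  with assms show ?thesis by blast
qed

lemma slocc_equiv_G_vec_transpose:
  assumes "i \<noteq> j"
  shows "slocc_equiv (G_vec x) (G_vec (\<chi> k. x $ Transposition.transpose i j k))"
proof -
  \<comment> \<open>The double swap followed by the swap of \<open>a\<close> and \<open>d\<close>
    leaves the middle swap; the other transpositions are conjugates of those already found.\<close>
  have swap23: "slocc_equiv (G_state a b c d) (G_state a c b d)" for a b c d
    using slocc_equiv_trans[OF slocc_equiv_G_swap14_23 slocc_equiv_G_swap14] .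
  have swap12: "slocc_equiv (G_state a b c d) (G_state b a c d)" for a b c d
    using slocc_equiv_trans[OF slocc_equiv_trans[OF slocc_equiv_G_swap14 slocc_equiv_G_swap24] slocc_equiv_G_swap14] .
  have swap34: "slocc_equiv (G_state a b c d) (G_state a b d c)" for a b c d
    using slocc_equiv_trans[OF slocc_equiv_trans[OF slocc_equiv_G_swap24 swap23] slocc_equiv_G_swap24] .
  have swap13: "slocc_equiv (G_state a b c d) (G_state c b a d)" for a b c d
    using slocc_equiv_trans[OF slocc_equiv_trans[OF slocc_equiv_G_swap14 swap34] slocc_equiv_G_swap14] .
  have "\<forall>i j. i \<noteq> j \<longrightarrow> slocc_equiv (G_vec x) (G_vec (\<chi> k. x $ Transposition.transpose i j k))"
    unfolding forall_4 by (simp add: G_vec_def Transposition.transpose_def swap23 swap12 swap34 swap13 slocc_equiv_G_swap14 slocc_equiv_G_swap24)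
  with assms show ?thesis by blast
qed

lemma slocc_equiv_G_vec_permutation:
  assumes "bij \<sigma>"
  shows "slocc_equiv (G_vec x) (G_vec (\<chi> i. x $ \<sigma> i))"
proof -
  have "\<sigma> permutes UNIV"
    using assms by (intro bij_imp_permutes) auto
  then show ?thesis
  proof (induction arbitrary: x rule: permutes_induct[OF _ finite[of UNIV], consumes 1, case_names id swap])
    case id
    show ?case
      using slocc_equiv_scale[of 1 "G_vec x"] by simp
  next
    case (swap i j \<sigma>)
    show ?case
      using slocc_equiv_trans[OF slocc_equiv_G_vec_transpose[OF \<open>i \<noteq> j\<close>] swap.IH] by simp
  qed
qed

lemma G_vec_scale: "G_vec (z *s x) = z *s G_vec x"
  by (simp add: G_vec_def G_state_scale)

lemma coeff_related_imp_slocc_equiv: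
  assumes "coeff_related x y"
  shows "slocc_equiv (G_vec x) (G_vec y)"
  using assms unfolding coeff_related_def
proof induction
  case base
  show ?case
    using slocc_equiv_scale[of 1 "G_vec x"] by simp
next
  case (step y w)
  from step.hyps(2) have "slocc_equiv (G_vec y) (G_vec w)"
    by cases (simp_all add: G_vec_scale slocc_equiv_scale slocc_equiv_G_vec_permutation slocc_equiv_G_vec_two_signs)
  with step.IH show ?case
    by (rule slocc_equiv_trans)
qed

section \<open>Norms of states and of coefficient tuples\<close>

lemma norm_G_vec: "norm (G_vec x) = norm x"
proof -
  have "(norm x)\<^sup>2 = (\<Sum>i\<in>UNIV. (cmod (x $ i))\<^sup>2)"
    by (simp add: norm_vec_def L2_set_def sum_nonneg)
  then have "(norm (G_vec x))\<^sup>2 = (norm x)\<^sup>2"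
    by (simp add: G_vec_def norm_G_state sum_4)
  then show ?thesis by simp
qed

text \<open>Every operation is an isometry; for equally normalised states this excludes a rescaling
  other than 1.\<close>

lemma coeff_related_imp_norm_eq:
  assumes "coeff_related x y"
  shows "norm x = norm y"
  using assms unfolding coeff_related_def
proof induction
  case (step y w)
  from step.hyps(2) have "norm y = norm w"
  proof cases
    case (permutation \<sigma>)
    then show ?thesis
      using sum.reindex_bij_betw[of \<sigma> UNIV UNIV "\<lambda>i. (cmod (y $ i))\<^sup>2"]
      by (simp add: norm_vec_def L2_set_def)
  next
    case (two_signs i j)
    have "norm (y $ k) = norm (w $ k)" for k by (simp add: two_signs)
    then show ?thesis by (simp add: norm_vec_def)
  qed (simp add: norm_vec_def L2_set_def norm_mult)
  with step.IH show ?case by simp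
qed simp

section \<open>Recovering operations from squares and product\<close>

lemma coeff_related_flip_signs:
  assumes "even (card S)"
  shows "coeff_related x (\<chi> k. if k \<in> S then - x $ k else x $ k)"
  using assms
proof (induction "card S" arbitrary: S rule: less_induct)
  case less
  show ?case
  proof (cases "S = {}")
    case False
    then obtain i where i: "i \<in> S" by blast
    have "S \<noteq> {i}" using less.prems by auto
    then obtain j where j: "j \<in> S" "j \<noteq> i" using i by blast
    have card: "card S = Suc (Suc (card (S - {i, j})))"
      using i j by (metis card.remove Diff_insert2 finite insertE Diff_iff)
    then have "coeff_related x (\<chi> k. if k \<in> S - {i, j} then - x $ k else x $ k)" (is "coeff_related x ?y")
      using less.prems by (intro less.hyps) auto
    moreover have "coeff_step ?y (\<chi> k. if k = i \<or> k = j then - ?y $ k else ?y $ k)"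
      using j by (intro two_signs) auto
    ultimately have "coeff_related x (\<chi> k. if k = i \<or> k = j then - ?y $ k else ?y $ k)"
      unfolding coeff_related_def by (rule rtranclp.rtrancl_into_rtrancl)
    also have "(\<chi> k. if k = i \<or> k = j then - ?y $ k else ?y $ k) = (\<chi> k. if k \<in> S then - x $ k else x $ k)"
      using i j by (auto simp: vec_eq_iff)
    finally show ?thesis .
  qed (simp add: coeff_related_def)
qed

lemma coeff_related_of_squares_eq:
  assumes squares: "\<And>i. (x $ i)\<^sup>2 = (y $ i)\<^sup>2"
    and prods: "(\<Prod>i\<in>UNIV. x $ i) = (\<Prod>i\<in>UNIV. y $ i)"
  shows "coeff_related x y"
proof -
  define N where "N = {i. x $ i \<noteq> y $ i}"
  have eq: "x $ i = (if i \<in> N then - 1 else 1) * y $ i" for i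
    using squares[of i] by (auto simp: N_def power2_eq_iff)
  show ?thesis
  proof (cases "even (card N)")
    case True
    have "(\<chi> k. if k \<in> N then - x $ k else x $ k) = y"
      by (simp add: vec_eq_iff eq)
    then show ?thesis
      using coeff_related_flip_signs[OF True, of x] by simp
  next
    \<comment> \<open>An odd number of sign changes negates the product, which must therefore
      vanish. A zero coordinate \<open>k\<close> joins \<open>N\<close> without altering the vector
      and makes the parity even.\<close>
    case False
    have "(\<Prod>i\<in>UNIV. x $ i) = (\<Prod>i\<in>UNIV. if i \<in> N then - 1 else 1) * (\<Prod>i\<in>UNIV. y $ i)"
      by (simp add: eq prod.distrib)
    also have "(\<Prod>i\<in>UNIV. if i \<in> N then - 1 else 1 :: complex) = (- 1) ^ card N"
      by (simp add: prod.If_cases)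
    finally have "(\<Prod>i\<in>UNIV. y $ i) = 0"
      using False prods by simp
    then obtain k where k: "y $ k = 0" by auto
    then have "k \<notin> N" using eq[of k] by (simp add: N_def)
    have "(\<chi> i. if i \<in> insert k N then - x $ i else x $ i) = y"
      using k by (auto simp: vec_eq_iff eq)
    moreover have "even (card (insert k N))"
      using False \<open>k \<notin> N\<close> by simp
    ultimately show ?thesis
      using coeff_related_flip_signs[of "insert k N" x] by simp
  qed
qed

text \<open>Permuting \<open>y\<close> by \<open>f\<close> aligns the squares and keeps the product;
  a final permutation by \<open>inv f\<close> restores \<open>y\<close>.\<close>

lemma coeff_related_of_permuted_squares_eq:
  assumes squares: "\<And>i. (x $ i)\<^sup>2 = (y $ f i)\<^sup>2" and f: "bij f"
    and prods: "(\<Prod>i\<in>UNIV. x $ i) = (\<Prod>i\<in>UNIV. y $ i)"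
  shows "coeff_related x y"
proof -
  have "coeff_related x (\<chi> i. y $ f i)"
    using squares prods prod.reindex_bij_betw[OF f, of "\<lambda>i. y $ i"]
    by (intro coeff_related_of_squares_eq) simp_all
  moreover have "coeff_step (\<chi> i. y $ f i) (\<chi> i. (\<chi> i. y $ f i) $ inv f i)"
    by (intro permutation bij_imp_bij_inv f)
  ultimately have "coeff_related x (\<chi> i. (\<chi> i. y $ f i) $ inv f i)"
    unfolding coeff_related_def by (rule rtranclp.rtrancl_into_rtrancl)
  also have "(\<chi> i. (\<chi> i. y $ f i) $ inv f i) = y"
    using f by (simp add: vec_eq_iff bij_is_surj surj_f_inv_f)
  finally show ?thesis .
qed

lemma slocc_equiv_imp_coeff_related:
  assumes slocc: "slocc_equiv (G_vec x) (G_vec y)" and inj: "inj (\<lambda>i. (x $ i)\<^sup>2)"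
  shows "\<exists>r>0. coeff_related x (complex_of_real r *s y)"
proof -
  obtain z where z: "z \<noteq> 0"
    and prods: "x$1 * x$2 * x$3 * x$4 = (z * y$1) * (z * y$2) * (z * y$3) * (z * y$4)"
    and squares: "{(x$1)\<^sup>2, (x$2)\<^sup>2, (x$3)\<^sup>2, (x$4)\<^sup>2} \<subseteq> {(z * y$1)\<^sup>2, (z * y$2)\<^sup>2, (z * y$3)\<^sup>2, (z * y$4)\<^sup>2}"
    using slocc unfolding G_vec_def by (rule slocc_equiv_G_state_invariants)
  have "\<forall>i. \<exists>j. (x $ i)\<^sup>2 = ((z *s y) $ j)\<^sup>2"
  proof
    fix i
    have "(x $ i)\<^sup>2 \<in> {(x$1)\<^sup>2, (x$2)\<^sup>2, (x$3)\<^sup>2, (x$4)\<^sup>2}"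
      using exhaust_4[of i] by auto
    with squares have "(x $ i)\<^sup>2 \<in> {(z * y$1)\<^sup>2, (z * y$2)\<^sup>2, (z * y$3)\<^sup>2, (z * y$4)\<^sup>2}"
      by (rule subsetD)
    also have "\<dots> = range (\<lambda>j. ((z *s y) $ j)\<^sup>2)"
      by (simp add: UNIV_4)
    finally show "\<exists>j. (x $ i)\<^sup>2 = ((z *s y) $ j)\<^sup>2"
      by (simp only: image_iff bex_UNIV)
  qed
  then obtain f where f: "\<forall>i. (x $ i)\<^sup>2 = ((z *s y) $ f i)\<^sup>2"
    by (rule choice[THEN exE])
  \<comment> \<open>Distinct squares of \<open>x\<close> force distinct values of \<open>f\<close>,
    and on a finite index type injectivity gives bijectivity.\<close>
  have "inj f"
  proof (rule injI)
    fix i j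
    assume "f i = f j"
    then have "(x $ i)\<^sup>2 = (x $ j)\<^sup>2"
      by (simp only: f[rule_format])
    with inj show "i = j"
      by (rule injD)
  qed
  then have "bij f"
    by (intro bijI finite_UNIV_inj_surj) simp_all
  moreover have "(\<Prod>i\<in>UNIV. x $ i) = (\<Prod>i\<in>UNIV. (z *s y) $ i)"
  proof -
    have "(\<Prod>i\<in>UNIV. g i) = g 1 * g 2 * g 3 * g 4" for g :: "4 \<Rightarrow> complex"
      unfolding UNIV_4 by (simp add: ac_simps)
    then show ?thesis
      using prods by (simp only: vector_smult_component)
  qed
  ultimately have "coeff_related x (z *s y)"
    by (intro coeff_related_of_permuted_squares_eq[of x "z *s y" f]) (rule f[rule_format])
  \<comment> \<open>A phase operation absorbs the argument of \<open>z\<close>; the modulus survives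
    as the witness for \<open>r\<close>.\<close>
  moreover have "coeff_step (z *s y) (cis (- Arg z) *s (z *s y))"
    by (rule phase)
  ultimately have "coeff_related x (cis (- Arg z) *s (z *s y))"
    unfolding coeff_related_def by (rule rtranclp.rtrancl_into_rtrancl)
  also have "cis (- Arg z) *s (z *s y) = complex_of_real (cmod z) *s y"
  proof -
    have "cis (- Arg z) * z = cis (- Arg z) * rcis (cmod z) (Arg z)"
      by (simp only: rcis_cmod_Arg)
    also have "\<dots> = complex_of_real (cmod z) * (cis (- Arg z) * cis (Arg z))"
      by (simp only: rcis_def mult.left_commute)
    finally have "cis (- Arg z) * z = complex_of_real (cmod z)"
      by (simp add: cis_mult)
    then show ?thesis by (simp add: vector_smult_assoc)
  qed
  finally have "coeff_related x (complex_of_real (cmod z) *s y)" .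
  then show ?thesis using z by (intro exI[of _ "cmod z"]) simp
qed

(* The three operations preserve the norm, whereas a projective point fixes a coefficient
   tuple only up to a nonzero factor. The first conjunct takes equally normalised
   representatives (in particular unit vectors); the second takes arbitrary ones, where
   the coefficients are determined up to a positive rescaling r. *)
theorem proposition4:
  fixes a b c d a' b' c' d' :: complex
  assumes "distinct [a\<^sup>2, b\<^sup>2, c\<^sup>2, d\<^sup>2]"
    and "distinct [a'\<^sup>2, b'\<^sup>2, c'\<^sup>2, d'\<^sup>2]"
  shows "(norm (G_state a b c d) = norm (G_state a' b' c' d') \<longrightarrow>
            (slocc_equiv (G_state a b c d) (G_state a' b' c' d') \<longleftrightarrow>
             coeff_related (vector [a, b, c, d]) (vector [a', b', c', d']))) \<and>
         (slocc_equiv (G_state a b c d) (G_state a' b' c' d') \<longleftrightarrow>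
            (\<exists>r>0. coeff_related (vector [a, b, c, d])
                     (complex_of_real r *s vector [a', b', c', d'])))"
proof -
  define x :: "complex^4" where "x = vector [a, b, c, d]"
  define y :: "complex^4" where "y = vector [a', b', c', d']"
  have G: "G_state a b c d = G_vec x" "G_state a' b' c' d' = G_vec y"
    by (simp_all add: G_vec_def x_def y_def)
  have "\<forall>i j. (x $ i)\<^sup>2 = (x $ j)\<^sup>2 \<longrightarrow> i = j" "x \<noteq> 0"
    using assms(1) unfolding forall_4 vec_eq_iff by (auto simp: x_def)
  then have inj: "inj (\<lambda>i. (x $ i)\<^sup>2)" by (simp add: inj_def)
  have iff: "slocc_equiv (G_vec x) (G_vec y) \<longleftrightarrow> (\<exists>r>0. coeff_related x (complex_of_real r *s y))"
  proof
    assume "\<exists>r>0. coeff_related x (complex_of_real r *s y)"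
    then obtain r where r: "r > 0" "slocc_equiv (G_vec x) (complex_of_real r *s G_vec y)"
      using coeff_related_imp_slocc_equiv G_vec_scale by metis
    have "slocc_equiv (complex_of_real r *s G_vec y) (G_vec y)"
      using slocc_equiv_scale[of "inverse (complex_of_real r)" "complex_of_real r *s G_vec y"] r(1)
      by (simp add: vector_smult_assoc)
    with r(2) show "slocc_equiv (G_vec x) (G_vec y)" by (rule slocc_equiv_trans)
  qed (rule slocc_equiv_imp_coeff_related[OF _ inj])
  have "slocc_equiv (G_vec x) (G_vec y) \<longleftrightarrow> coeff_related x y" if "norm (G_vec x) = norm (G_vec y)"
  proof
    assume "slocc_equiv (G_vec x) (G_vec y)"
    then obtain r where r: "r > 0" "coeff_related x (complex_of_real r *s y)"
      using iff by blast
    have "norm y = norm (complex_of_real r *s y)"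
      using coeff_related_imp_norm_eq[OF r(2)] that by (simp add: norm_G_vec)
    also have "\<dots> = r * norm y"
      using r(1) by (simp add: norm_vec_def L2_set_right_distrib norm_mult)
    \<comment> \<open>Cancels \<open>norm y\<close>, which equals \<open>norm x\<close> and is
      therefore nonzero.\<close>
    finally have "r = 1"
      using that \<open>x \<noteq> 0\<close> by (auto simp: norm_G_vec)
    with r(2) show "coeff_related x y" by simp
  qed (rule coeff_related_imp_slocc_equiv)
  with iff show ?thesis
    unfolding G x_def[symmetric] y_def[symmetric] by (intro conjI impI)
qed

end
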